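(* Let $m\ge 1$ be an integer, let $\mathfrak q=\mathfrak q(x)$ be a smooth real function on an open interval $I$, and consider the system of $m$ linear second order ordinary differential equations $$\mathbf y''+\mathfrak q(x)\,\mathbf y=0,\qquad \mathbf y=(y_1,\dots,y_m)\in\mathbb R^m .$$ Let $u,v$ be two linearly independent solutions on $I$ of the scalar equation $y''+\mathfrak q\,y=0$, normalized so that $uv'-u'v=1$, and put $u_1=u$, $u_2=v$, $u_k'=du_k/dx$. Then the Lie point symmetry algebra of the system has the $2m$ non-Cartan symmetries $$C_{ik}=y_i\,u_k\,\frac{\partial}{\partial x}+\sum_{j=1}^m y_i\,y_j\,u_k'\,\frac{\partial}{\partial y_j},\qquad i=1,\dots,m,\quad k=1,2 .$$ Moreover, these non-Cartan symmetries form an abelian Lie algebra (that is, $[C_{ik},C_{jl}]=0$ for all $i,j\in\{1,\dots,m\}$ and $k,l\in\{1,2\}$).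
   Context: A (Lie point) symmetry of a system of differential equations $\Delta=(\Delta_1,\dots,\Delta_m)=0$ of order $p$ with independent variable $x$ and dependent variables $\mathbf y=(y_1,\dots,y_m)$ is a smooth vector field $$\mathbf v=\xi(x,\mathbf y)\,\frac{\partial}{\partial x}+\sum_{j=1}^m\phi_j(x,\mathbf y)\,\frac{\partial}{\partial y_j}$$ satisfying the infinitesimal invariance condition $\mathbf v^{(p)}(\Delta_\nu)\big|_{\Delta=0}=0$ for all $\nu=1,\dots,m$, where $\mathbf v^{(p)}$ is the $p$th prolongation of $\mathbf v$ to the jet space. The symmetries form a Lie algebra under the commutator of vector fields, the Lie point symmetry algebra of the system. A symmetry $\mathbf v$ is called non-Cartan if $\xi$ depends explicitly on at least one of the dependent variables $y_j$ (i.e. some $\partial\xi/\partial y_j$ is not identically zero). The systems $\mathbf y''+\mathfrak q\,\mathbf y=0$ with scalar $\mathfrak q$ are the normal forms (no first-derivative term) of the linear systems in the canonical class, i.e. the class of systems of $m$ linear second order ordinary differential equations equivalent under point transformations to the trivial system $\mathbf y''=0$. *)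

theory Defs
  imports "HOL-Analysis.Analysis"
begin

text \<open>Smoothness is meant for open sets \<open>S\<close> and finite-dimensional domains, where continuity of
  all iterated directional derivatives is the usual \<open>C^k\<close> condition.\<close>

fun C_k_on :: "nat \<Rightarrow> 'a::real_normed_vector set \<Rightarrow> ('a \<Rightarrow> 'b::real_normed_vector) \<Rightarrow> bool" where
  "C_k_on 0 S f \<longleftrightarrow> continuous_on S f"
| "C_k_on (Suc n) S f \<longleftrightarrow>
     (\<forall>x\<in>S. f differentiable (at x)) \<and>
     (\<forall>h. C_k_on n S (\<lambda>x. frechet_derivative f (at x) h))"

definition smooth_on :: "'a::real_normed_vector set \<Rightarrow> ('a \<Rightarrow> 'b::real_normed_vector) \<Rightarrow> bool" where
  "smooth_on S f \<longleftrightarrow> (\<forall>n. C_k_on n S f)"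

text \<open>A vector field \<open>\<xi> \<partial>/\<partial>x + (\<Sum>j. \<phi>\<^sub>j \<partial>/\<partial>y\<^sub>j)\<close> on a set of points \<open>(x, y)\<close> is the map
  \<open>V = (\<xi>, \<phi>)\<close>, so \<open>\<xi> = fst \<circ> V\<close> and \<open>\<phi> = snd \<circ> V\<close>. Only its values on the domain under
  consideration matter.\<close>

type_synonym 'm vfield = "real \<times> (real ^ 'm) \<Rightarrow> real \<times> (real ^ 'm)"

text \<open>A jet \<open>(x, w)\<close> has the coordinates \<open>w k = y^(k)\<close>. All orders share this one type; a function
  on the jet space of order \<open>n\<close> is one that only inspects \<open>w 0, \<dots>, w n\<close>.\<close>

type_synonym 'm jet = "real \<times> (nat \<Rightarrow> real ^ 'm)"

definition jet_base :: "'m jet \<Rightarrow> real \<times> (real ^ 'm)" where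
  "jet_base z = (fst z, snd z 0)"

definition jet_dx :: "('m jet \<Rightarrow> real) \<Rightarrow> 'm jet \<Rightarrow> real" where
  "jet_dx F z = deriv (\<lambda>t. F (t, snd z)) (fst z)"

definition jet_dy :: "nat \<Rightarrow> 'm::finite \<Rightarrow> ('m jet \<Rightarrow> real) \<Rightarrow> 'm jet \<Rightarrow> real" where
  "jet_dy k j F z =
     deriv (\<lambda>t. F (fst z, (snd z)(k := snd z k + t *\<^sub>R axis j 1))) 0"

text \<open>Total derivative \<open>D\<^sub>x\<close> of a function on the jet space of order \<open>n\<close>.\<close>

definition total_deriv :: "nat \<Rightarrow> ('m::finite jet \<Rightarrow> real) \<Rightarrow> 'm jet \<Rightarrow> real" where
  "total_deriv n F z =
     jet_dx F z + (\<Sum>k\<le>n. \<Sum>j\<in>UNIV. snd z (Suc k) $ j * jet_dy k j F z)"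

text \<open>The coefficient of \<open>\<partial>/\<partial>y\<^sub>j^(k)\<close> in the prolongation of \<open>V\<close>; it lives on the jet space of
  order \<open>k\<close>.\<close>

fun prolong_coeff :: "'m::finite vfield \<Rightarrow> nat \<Rightarrow> 'm \<Rightarrow> 'm jet \<Rightarrow> real" where
  "prolong_coeff V 0 j z = snd (V (jet_base z)) $ j"
| "prolong_coeff V (Suc k) j z =
     total_deriv k (prolong_coeff V k j) z
     - snd z (Suc k) $ j * total_deriv 0 (\<lambda>z. fst (V (jet_base z))) z"

text \<open>Action of the prolongation of order \<open>p\<close> on a function on the jet space of order \<open>p\<close>.\<close>

definition prolong_apply :: "nat \<Rightarrow> 'm::finite vfield \<Rightarrow> ('m jet \<Rightarrow> real) \<Rightarrow> 'm jet \<Rightarrow> real" where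
  "prolong_apply p V F z =
     fst (V (jet_base z)) * jet_dx F z
     + (\<Sum>k\<le>p. \<Sum>j\<in>UNIV. prolong_coeff V k j z * jet_dy k j F z)"

text \<open>\<open>\<Delta>\<close> collects the left-hand sides \<open>\<Delta>\<^sub>\<nu>\<close> of a system of order \<open>p\<close> over the domain \<open>M\<close>.\<close>

definition lie_symmetry_algebra ::
  "nat \<Rightarrow> (real \<times> (real ^ 'm)) set \<Rightarrow> ('m::finite jet \<Rightarrow> real ^ 'm) \<Rightarrow> 'm vfield set" where
  "lie_symmetry_algebra p M \<Delta> =
     {V. smooth_on M V \<and>
         (\<forall>z. jet_base z \<in> M \<longrightarrow> (\<forall>\<nu>. \<Delta> z $ \<nu> = 0) \<longrightarrow>
              (\<forall>\<nu>. prolong_apply p V (\<lambda>z. \<Delta> z $ \<nu>) z = 0))}"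

definition non_Cartan :: "(real \<times> (real ^ 'm)) set \<Rightarrow> 'm::finite vfield \<Rightarrow> bool" where
  "non_Cartan M V \<longleftrightarrow>
     (\<exists>j. \<exists>(x, y)\<in>M. deriv (\<lambda>t. fst (V (x, y + t *\<^sub>R axis j 1))) 0 \<noteq> 0)"

text \<open>The components of \<open>[V, W]\<close> are \<open>V(W\<^sup>a) - W(V\<^sup>a)\<close>.\<close>

definition lie_bracket :: "'m::finite vfield \<Rightarrow> 'm vfield \<Rightarrow> 'm vfield" where
  "lie_bracket V W z =
     frechet_derivative W (at z) (V z) - frechet_derivative V (at z) (W z)"

definition linear_system :: "(real \<Rightarrow> real) \<Rightarrow> 'm::finite jet \<Rightarrow> real ^ 'm" where
  "linear_system q = (\<lambda>(x, w). w 2 + q x *\<^sub>R w 0)"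

definition scalar_solution :: "real set \<Rightarrow> (real \<Rightarrow> real) \<Rightarrow> (real \<Rightarrow> real) \<Rightarrow> bool" where
  "scalar_solution I q f \<longleftrightarrow>
     (\<forall>x\<in>I. f field_differentiable at x \<and> deriv f field_differentiable at x \<and>
            deriv (deriv f) x + q x * f x = 0)"

text \<open>The index \<open>k\<close> is meant to range over \<open>{1, 2}\<close>, with \<open>u\<^sub>1 = u\<close> and \<open>u\<^sub>2 = v\<close>.\<close>

definition C_field ::
  "(real \<Rightarrow> real) \<Rightarrow> (real \<Rightarrow> real) \<Rightarrow> 'm::finite \<Rightarrow> nat \<Rightarrow> 'm vfield" where
  "C_field u v i k =
     (\<lambda>(x, y). let f = (if k = 1 then u else v)
       in (y $ i * f x, (\<chi> j. y $ i * y $ j * deriv f x)))"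

end

theory Submission
  imports Defs
begin

text \<open>With \<open>f'' = - q f\<close>, solutions of the scalar equation are smooth by bootstrapping, and the second
  prolongation of \<open>y\<^sub>i f \<partial>/\<partial>x + \<Sum>j. y\<^sub>i y\<^sub>j f' \<partial>/\<partial>y\<^sub>j\<close> has a closed form that can be evaluated on \<open>y'' = - q y\<close>.
  Both components of \<open>V(W)\<close> for two such fields, built from \<open>(i, f)\<close> and \<open>(j, g)\<close>, are symmetric
  under swapping the two pairs, because \<open>f g'' = - q f g = f'' g\<close>; hence the bracket vanishes.\<close>

section \<open>Functions with continuous iterated derivatives\<close>

text \<open>A Frechet derivative at a point of an open set depends only on the values in that set,
  so agreement on \<open>S\<close> passes to the derivatives at each level of the recursion.\<close>

lemma C_k_on_cong:
  assumes "open S" and "\<And>x. x \<in> S \<Longrightarrow> f x = g x" and "C_k_on n S f"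
  shows "C_k_on n S g"
  using assms(2,3)
proof (induction n arbitrary: f g)
  case 0
  then show ?case by (simp cong: continuous_on_cong)
next
  case (Suc n)
  have der: "(g has_derivative frechet_derivative f (at x)) (at x)" if "x \<in> S" for x
  proof (rule has_derivative_transform_within_open[OF _ \<open>open S\<close> that])
    show "(f has_derivative frechet_derivative f (at x)) (at x)"
      using Suc.prems(2) that by (simp add: frechet_derivative_works)
  qed (use Suc.prems(1) in auto)
  then have "frechet_derivative f (at x) = frechet_derivative g (at x)" if "x \<in> S" for x
    using frechet_derivative_at that by blast
  then have "C_k_on n S (\<lambda>x. frechet_derivative g (at x) h)" for h
    using Suc.IH[of "\<lambda>x. frechet_derivative f (at x) h"] Suc.prems(2) by simp
  then show ?case
    using der by (auto simp: differentiable_def)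
qed

lemma C_k_on_SucD: "C_k_on (Suc n) S f \<Longrightarrow> C_k_on n S f"
proof (induction n arbitrary: f)
  case 0
  then show ?case
    by (auto intro!: continuous_at_imp_continuous_on differentiable_imp_continuous_within)
next
  case (Suc n)
  then show ?case by (metis C_k_on.simps(2))
qed

text \<open>By uniqueness of derivatives an explicit candidate \<open>D\<close> can stand in for the
  choice term \<open>frechet_derivative\<close>. They agree only on \<open>S\<close>, hence the
  appeal to \<open>C_k_on_cong\<close>. The closure lemmas below all go through this rule.\<close>

lemma C_k_on_SucI:
  assumes "open S" and "\<And>x. x \<in> S \<Longrightarrow> (f has_derivative D x) (at x)"
    and "\<And>h. C_k_on n S (\<lambda>x. D x h)"
  shows "C_k_on (Suc n) S f"
proof -
  have "D x = frechet_derivative f (at x)" if "x \<in> S" for x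
    using frechet_derivative_at assms(2) that by blast
  then have "C_k_on n S (\<lambda>x. frechet_derivative f (at x) h)" for h
    using C_k_on_cong[OF assms(1) _ assms(3)[of h]] by simp
  then show ?thesis
    using assms(2) by (auto simp: differentiable_def)
qed

lemma C_k_on_SucE:
  assumes "C_k_on (Suc n) S f" and "x \<in> S"
  shows "(f has_derivative frechet_derivative f (at x)) (at x)"
  using assms by (simp add: frechet_derivative_works)

lemma C_k_on_const: "open S \<Longrightarrow> C_k_on n S (\<lambda>_. c)"
proof (induction n arbitrary: c)
  case (Suc n)
  show ?case
    by (rule C_k_on_SucI[where D = "\<lambda>_ _. 0"]) (use Suc in auto)
qed simp

lemma C_k_on_bounded_linear:
  assumes "open S" and "bounded_linear L"
  shows "C_k_on n S L"
proof (cases n)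
  case 0
  then show ?thesis by (simp add: assms(2) linear_continuous_on)
next
  case (Suc k)
  have "C_k_on (Suc k) S L"
    by (rule C_k_on_SucI[where D = "\<lambda>_. L"])
      (use assms in \<open>auto intro: bounded_linear_imp_has_derivative C_k_on_const\<close>)
  then show ?thesis using Suc by simp
qed

lemma C_k_on_add:
  assumes "open S"
  shows "C_k_on n S f \<Longrightarrow> C_k_on n S g \<Longrightarrow> C_k_on n S (\<lambda>x. f x + g x)"
proof (induction n arbitrary: f g)
  case 0
  then show ?case by (simp add: continuous_on_add)
next
  case (Suc n)
  show ?case
  proof (rule C_k_on_SucI[OF assms])
    show "((\<lambda>x. f x + g x) has_derivative
        (\<lambda>h. frechet_derivative f (at x) h + frechet_derivative g (at x) h)) (at x)"
      if "x \<in> S" for x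
      by (intro has_derivative_add C_k_on_SucE[OF Suc.prems(1) that] C_k_on_SucE[OF Suc.prems(2) that])
  qed (use Suc in auto)
qed

text \<open>Both summands of the product rule pair an undifferentiated factor with a derivative. The
  induction hypothesis needs both at level \<open>n\<close>, so the undifferentiated factor is
  lowered by \<open>C_k_on_SucD\<close>.\<close>

lemma (in bounded_bilinear) C_k_on_prod:
  assumes "open S"
  shows "C_k_on n S f \<Longrightarrow> C_k_on n S g \<Longrightarrow> C_k_on n S (\<lambda>x. prod (f x) (g x))"
proof (induction n arbitrary: f g)
  case 0
  then show ?case by (simp add: continuous_on)
next
  case (Suc n)
  show ?case
  proof (rule C_k_on_SucI[OF assms])
    show "((\<lambda>x. prod (f x) (g x)) has_derivative
        (\<lambda>h. prod (f x) (frechet_derivative g (at x) h) + prod (frechet_derivative f (at x) h) (g x)))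
        (at x)"
      if "x \<in> S" for x
      by (intro FDERIV C_k_on_SucE[OF Suc.prems(1) that] C_k_on_SucE[OF Suc.prems(2) that])
    show "C_k_on n S (\<lambda>x. prod (f x) (frechet_derivative g (at x) h)
        + prod (frechet_derivative f (at x) h) (g x))" for h
      using Suc.prems C_k_on_SucD[OF Suc.prems(1)] C_k_on_SucD[OF Suc.prems(2)]
      by (intro C_k_on_add assms Suc.IH) auto
  qed
qed

lemma C_k_on_Pair:
  assumes "open S"
  shows "C_k_on n S f \<Longrightarrow> C_k_on n S g \<Longrightarrow> C_k_on n S (\<lambda>x. (f x, g x))"
proof (induction n arbitrary: f g)
  case 0
  then show ?case by (simp add: continuous_on_Pair)
next
  case (Suc n)
  show ?case
  proof (rule C_k_on_SucI[OF assms])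
    show "((\<lambda>x. (f x, g x)) has_derivative
        (\<lambda>h. (frechet_derivative f (at x) h, frechet_derivative g (at x) h))) (at x)"
      if "x \<in> S" for x
      by (intro has_derivative_Pair C_k_on_SucE[OF Suc.prems(1) that] C_k_on_SucE[OF Suc.prems(2) that])
  qed (use Suc in auto)
qed

text \<open>For linear \<open>L\<close> the derivative in direction \<open>h\<close> is the
  derivative of \<open>f\<close> in the fixed direction \<open>L h\<close>, again composed with
  \<open>L\<close>. The induction therefore closes without a general chain rule for C^k
  maps.\<close>

lemma C_k_on_compose_linear:
  assumes "open S" and L: "bounded_linear L" and sub: "\<And>x. x \<in> S \<Longrightarrow> L x \<in> T"
  shows "C_k_on n T f \<Longrightarrow> C_k_on n S (\<lambda>x. f (L x))"
proof (induction n arbitrary: f)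
  case 0
  then show ?case
    using continuous_on_compose2[OF _ linear_continuous_on[OF L]] sub by auto
next
  case (Suc n)
  show ?case
  proof (rule C_k_on_SucI[OF assms(1)])
    show "((\<lambda>x. f (L x)) has_derivative (\<lambda>h. frechet_derivative f (at (L x)) (L h))) (at x)"
      if "x \<in> S" for x
      using diff_chain_at[OF bounded_linear_imp_has_derivative[OF L] C_k_on_SucE[OF Suc.prems sub[OF that]]]
      by (simp add: o_def)
  qed (use Suc in auto)
qed

section \<open>Solutions of the scalar equation\<close>

lemma scalar_solution_derivs:
  assumes "scalar_solution I q f" and "x \<in> I"
  shows "(f has_real_derivative deriv f x) (at x)"
    and "(deriv f has_real_derivative - (q x * f x)) (at x)"
proof -
  show "(f has_real_derivative deriv f x) (at x)"
    using assms by (simp add: scalar_solution_def DERIV_deriv_iff_field_differentiable)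
  have "deriv (deriv f) x = - (q x * f x)"
    using assms by (simp add: scalar_solution_def eq_neg_iff_add_eq_0)
  then show "(deriv f has_real_derivative - (q x * f x)) (at x)"
    using assms by (metis scalar_solution_def DERIV_deriv_iff_field_differentiable)
qed

text \<open>The bootstrapping runs on the pair: f gains a level because its derivative is f', and f'
  gains one because its derivative is - q f.\<close>

lemma C_k_on_scalar_solution:
  assumes "open I" and "smooth_on I q" and sol: "scalar_solution I q f"
  shows "C_k_on n I f \<and> C_k_on n I (deriv f)"
proof (induction n)
  case 0
  have "continuous (at x) f \<and> continuous (at x) (deriv f)" if "x \<in> I" for x
    using scalar_solution_derivs[OF sol that] DERIV_isCont by blast
  then show ?case
    by (simp add: continuous_at_imp_continuous_on)
next
  case (Suc n)
  have q: "C_k_on n I q"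
    using assms(2) by (simp add: smooth_on_def)
  have "C_k_on (Suc n) I f"
  proof (rule C_k_on_SucI[OF assms(1)])
    show "(f has_derivative (*) (deriv f x)) (at x)" if "x \<in> I" for x
      using scalar_solution_derivs(1)[OF sol that] by (simp add: has_field_derivative_def)
    show "C_k_on n I (\<lambda>x. deriv f x * h)" for h
      using Suc by (intro bounded_bilinear.C_k_on_prod[OF bounded_bilinear_mult] C_k_on_const assms) auto
  qed
  moreover have "C_k_on (Suc n) I (deriv f)"
  proof (rule C_k_on_SucI[OF assms(1)])
    show "(deriv f has_derivative (*) (- (q x * f x))) (at x)" if "x \<in> I" for x
      using scalar_solution_derivs(2)[OF sol that] by (simp add: has_field_derivative_def)
    \<comment> \<open>The sign is moved into the constant factor - h, so that closure under products
      and constants is enough.\<close>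
    have "C_k_on n I (\<lambda>x. (q x * f x) * (- h))" for h
      using Suc q by (intro bounded_bilinear.C_k_on_prod[OF bounded_bilinear_mult] C_k_on_const assms) auto
    then show "C_k_on n I (\<lambda>x. - (q x * f x) * h)" for h
      by simp
  qed
  ultimately show ?case by simp
qed

section \<open>The non-Cartan vector fields\<close>

text \<open>The \<phi>-part is written as a scalar multiple of the vector y, so that the smoothness
  and derivative rules for products apply without going into components.\<close>

definition C_fun :: "(real \<Rightarrow> real) \<Rightarrow> 'm::finite \<Rightarrow> 'm vfield" where
  "C_fun f i z = (snd z $ i * f (fst z), (snd z $ i * deriv f (fst z)) *\<^sub>R snd z)"

lemma C_field_eq_C_fun: "C_field u v i k = C_fun (if k = 1 then u else v) i"
  by (auto simp: C_field_def C_fun_def Let_def vec_eq_iff fun_eq_iff)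

lemma smooth_on_C_fun:
  fixes i :: "'m::finite"
  assumes "open I" and "smooth_on I q" and "scalar_solution I q f"
  shows "smooth_on (I \<times> UNIV) (C_fun f i)"
  unfolding smooth_on_def
proof
  fix n
  have op: "open (I \<times> (UNIV :: (real ^ 'm) set))"
    using assms(1) by (simp add: open_Times)
  have y: "C_k_on n (I \<times> UNIV) (\<lambda>z. snd z $ i :: real)"
    by (rule C_k_on_bounded_linear[OF op
        bounded_linear_compose[OF bounded_linear_vec_nth bounded_linear_snd]])
  have f: "C_k_on n (I \<times> (UNIV :: (real ^ 'm) set)) (\<lambda>z. f (fst z))"
    and f': "C_k_on n (I \<times> (UNIV :: (real ^ 'm) set)) (\<lambda>z. deriv f (fst z))"
    using C_k_on_scalar_solution[OF assms, of n]
    by (auto intro!: C_k_on_compose_linear[OF op bounded_linear_fst, of I])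
  show "C_k_on n (I \<times> UNIV) (C_fun f i)"
    unfolding C_fun_def[abs_def]
    by (intro C_k_on_Pair op bounded_bilinear.C_k_on_prod[OF bounded_bilinear_mult]
        bounded_bilinear.C_k_on_prod[OF bounded_bilinear_scaleR] y f f'
        C_k_on_bounded_linear bounded_linear_snd)
qed

lemma lie_bracket_C_fun:
  assumes sol: "scalar_solution I q f" "scalar_solution I q g" and z: "fst z \<in> I"
  shows "lie_bracket (C_fun f i) (C_fun g j) z = 0"
proof -
  \<comment> \<open>With f'' already replaced by - q f, the bracket becomes a polynomial identity in
    q, f, f', g, g' and the entries of y.\<close>
  have fd: "frechet_derivative (C_fun f i) (at z) =
      (\<lambda>h. (snd h $ i * f (fst z) + snd z $ i * (deriv f (fst z) * fst h),
        (snd h $ i * deriv f (fst z) - snd z $ i * (q (fst z) * f (fst z) * fst h)) *\<^sub>R snd z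
        + (snd z $ i * deriv f (fst z)) *\<^sub>R snd h))"
    if "scalar_solution I q f" for f and i :: 'a
  proof (rule sym, rule frechet_derivative_at)
    have d: "((\<lambda>z. f (fst z)) has_derivative (\<lambda>h. deriv f (fst z) * fst h)) (at z)"
      "((\<lambda>z. deriv f (fst z)) has_derivative (\<lambda>h. - (q (fst z) * f (fst z)) * fst h)) (at z)"
      by (rule has_derivative_compose[OF bounded_linear_imp_has_derivative[OF bounded_linear_fst]
            scalar_solution_derivs(1)[OF that z, unfolded has_field_derivative_def]],
          rule has_derivative_compose[OF bounded_linear_imp_has_derivative[OF bounded_linear_fst]
            scalar_solution_derivs(2)[OF that z, unfolded has_field_derivative_def]])
    show "(C_fun f i has_derivative
      (\<lambda>h. (snd h $ i * f (fst z) + snd z $ i * (deriv f (fst z) * fst h),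
        (snd h $ i * deriv f (fst z) - snd z $ i * (q (fst z) * f (fst z) * fst h)) *\<^sub>R snd z
        + (snd z $ i * deriv f (fst z)) *\<^sub>R snd h))) (at z)"
      unfolding C_fun_def[abs_def]
      by (rule derivative_eq_intros d bounded_linear.has_derivative[OF bounded_linear_vec_nth] refl)+
        (simp add: algebra_simps)
  qed
  show ?thesis
    by (simp add: lie_bracket_def fd[OF sol(1)] fd[OF sol(2)])
      (simp add: C_fun_def zero_prod_def vec_eq_iff algebra_simps)
qed

section \<open>Second prolongation\<close>

text \<open>The derivatives in the jet variables keep x fixed, and the one in x only sees nearby
  points, which stay in the open set \<open>I\<close>. This allows closed forms valid only over
  \<open>I\<close> to be differentiated.\<close>

lemma total_deriv_cong:
  assumes "open I" and "fst z \<in> I" and eq: "\<And>z. fst z \<in> I \<Longrightarrow> F z = G z"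
  shows "total_deriv n F z = total_deriv n G z"
proof -
  have "\<forall>\<^sub>F t in nhds (fst z). F (t, snd z) = G (t, snd z)"
    using eventually_nhds_in_open[OF assms(1,2)] by eventually_elim (simp add: eq)
  then show ?thesis
    by (simp add: total_deriv_def jet_dx_def jet_dy_def deriv_cong_ev eq assms(2))
qed

lemma sum_mult_axis:
  fixes a :: "real ^ 'm::finite"
  shows "(\<Sum>l\<in>UNIV. a $ l * axis l 1 $ i) = a $ i"
    and "(\<Sum>l\<in>UNIV. a $ l * (axis l 1 $ i * c)) = a $ i * c"
    by (auto simp: axis_def if_distrib if_distribR cong: if_cong)

lemma total_deriv_xi:
  assumes "(f has_real_derivative f') (at (fst z))"
  shows "total_deriv 0 (\<lambda>z. snd z 0 $ i * f (fst z)) z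
    = snd z 0 $ i * f' + snd z 1 $ i * f (fst z)"
proof -
  have "jet_dx (\<lambda>z. snd z 0 $ i * f (fst z)) z = snd z 0 $ i * f'"
    unfolding jet_dx_def by (rule DERIV_imp_deriv) (auto intro!: derivative_eq_intros assms)
  moreover have "jet_dy 0 l (\<lambda>z. snd z 0 $ i * f (fst z)) z = axis l 1 $ i * f (fst z)" for l
    unfolding jet_dy_def by (rule DERIV_imp_deriv) (auto intro!: derivative_eq_intros)
  ultimately show ?thesis
    by (simp add: total_deriv_def sum_mult_axis)
qed

text \<open>This is D_x \<phi>_j - y_j' D_x \<xi> with f'' = - q f inserted; the term y_i y_j' f'
  occurs in both parts and cancels.\<close>

lemma prolong_coeff_C_fun_1:
  assumes "scalar_solution I q f" and "fst z \<in> I"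
  shows "prolong_coeff (C_fun f i) 1 j z =
      - (q (fst z) * f (fst z)) * snd z 0 $ i * snd z 0 $ j
      + snd z 1 $ i * snd z 0 $ j * deriv f (fst z) - snd z 1 $ i * snd z 1 $ j * f (fst z)"
proof -
  let ?\<phi> = "\<lambda>z. snd z 0 $ i * deriv f (fst z) * snd z 0 $ j"
  note d = scalar_solution_derivs[OF assms]
  have "jet_dx ?\<phi> z = - (q (fst z) * f (fst z)) * snd z 0 $ i * snd z 0 $ j"
    unfolding jet_dx_def by (rule DERIV_imp_deriv) (auto intro!: derivative_eq_intros d)
  moreover have "jet_dy 0 l ?\<phi> z = axis l 1 $ i * (deriv f (fst z) * snd z 0 $ j)
      + axis l 1 $ j * (snd z 0 $ i * deriv f (fst z))" for l
    unfolding jet_dy_def by (rule DERIV_imp_deriv) (auto intro!: derivative_eq_intros)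
  ultimately have "total_deriv 0 ?\<phi> z = - (q (fst z) * f (fst z)) * snd z 0 $ i * snd z 0 $ j
      + snd z 1 $ i * deriv f (fst z) * snd z 0 $ j + snd z 1 $ j * snd z 0 $ i * deriv f (fst z)"
    by (simp add: total_deriv_def sum_mult_axis distrib_left sum.distrib)
  moreover have "prolong_coeff (C_fun f i) 0 j = ?\<phi>"
    by (auto simp: fun_eq_iff C_fun_def jet_base_def)
  moreover have "total_deriv 0 (\<lambda>z. fst (C_fun f i (jet_base z))) z
      = snd z 0 $ i * deriv f (fst z) + snd z 1 $ i * f (fst z)"
    using total_deriv_xi[OF d(1)] by (simp add: C_fun_def jet_base_def)
  ultimately show ?thesis
    by (simp add: algebra_simps del: prolong_coeff.simps(1))
qed

text \<open>The recursion is applied once more to the first-order closed form. That form contains q,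
  which brings in q'. The coordinates y'' are still free here; the system is imposed only
  later.\<close>

lemma prolong_coeff_C_fun_2:
  assumes "open I" and sol: "scalar_solution I q f" and z: "fst z \<in> I"
    and q': "(q has_real_derivative q') (at (fst z))"
  shows "prolong_coeff (C_fun f i) 2 j z =
      - (q' * f (fst z) + q (fst z) * deriv f (fst z)) * snd z 0 $ i * snd z 0 $ j
      - q (fst z) * f (fst z) * (2 * snd z 1 $ i * snd z 0 $ j + snd z 0 $ i * snd z 1 $ j)
      + (snd z 2 $ i * snd z 0 $ j - snd z 0 $ i * snd z 2 $ j) * deriv f (fst z)
      - (snd z 2 $ i * snd z 1 $ j + 2 * snd z 1 $ i * snd z 2 $ j) * f (fst z)"
proof -
  let ?\<phi> = "\<lambda>z. - (q (fst z) * f (fst z)) * snd z 0 $ i * snd z 0 $ j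
      + snd z 1 $ i * snd z 0 $ j * deriv f (fst z) - snd z 1 $ i * snd z 1 $ j * f (fst z)"
  let ?q = "q (fst z)" and ?f = "f (fst z)" and ?f' = "deriv f (fst z)"
  note d = scalar_solution_derivs[OF sol z]
  have x: "jet_dx ?\<phi> z = - (q' * ?f + ?q * ?f') * snd z 0 $ i * snd z 0 $ j
      - snd z 1 $ i * snd z 0 $ j * (?q * ?f) - snd z 1 $ i * snd z 1 $ j * ?f'"
    unfolding jet_dx_def
    by (rule DERIV_imp_deriv) (auto intro!: derivative_eq_intros d q' simp: algebra_simps)
  have y: "jet_dy 0 l ?\<phi> z = axis l 1 $ i * (- (?q * ?f) * snd z 0 $ j)
      + axis l 1 $ j * (- (?q * ?f) * snd z 0 $ i + snd z 1 $ i * ?f')" for l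
    unfolding jet_dy_def
    by (rule DERIV_imp_deriv) (auto intro!: derivative_eq_intros simp: algebra_simps)
  have p: "jet_dy 1 l ?\<phi> z = axis l 1 $ i * (snd z 0 $ j * ?f' - snd z 1 $ j * ?f)
      + axis l 1 $ j * (- (snd z 1 $ i * ?f))" for l
    unfolding jet_dy_def
    by (rule DERIV_imp_deriv) (auto intro!: derivative_eq_intros simp: algebra_simps)
  have split: "total_deriv 1 F z = jet_dx F z + (\<Sum>l\<in>UNIV. snd z 1 $ l * jet_dy 0 l F z)
      + (\<Sum>l\<in>UNIV. snd z 2 $ l * jet_dy 1 l F z)" for F
    by (simp add: total_deriv_def numeral_2_eq_2)
  have "total_deriv 1 ?\<phi> z = jet_dx ?\<phi> z
      + snd z 1 $ i * (- (?q * ?f) * snd z 0 $ j)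
      + snd z 1 $ j * (- (?q * ?f) * snd z 0 $ i + snd z 1 $ i * ?f')
      + snd z 2 $ i * (snd z 0 $ j * ?f' - snd z 1 $ j * ?f)
      + snd z 2 $ j * (- (snd z 1 $ i * ?f))"
    unfolding split y p by (simp only: distrib_left[of "snd z _ $ _"] sum.distrib sum_mult_axis)
  \<comment> \<open>The first-order coefficient may be replaced before differentiating, since its
    closed form holds at all jets over \<open>I\<close> and not just at \<open>z\<close>.\<close>
  moreover have "total_deriv 1 (prolong_coeff (C_fun f i) 1 j) z = total_deriv 1 ?\<phi> z"
    by (rule total_deriv_cong[OF assms(1) z prolong_coeff_C_fun_1[OF sol]])
  moreover have "total_deriv 0 (\<lambda>z. fst (C_fun f i (jet_base z))) z
      = snd z 0 $ i * ?f' + snd z 1 $ i * ?f"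
    using total_deriv_xi[OF d(1)] by (simp add: C_fun_def jet_base_def)
  moreover have "prolong_coeff (C_fun f i) 2 j z = total_deriv 1 (prolong_coeff (C_fun f i) 1 j) z
      - snd z 2 $ j * total_deriv 0 (\<lambda>z. fst (C_fun f i (jet_base z))) z"
    by (simp only: numeral_2_eq_2 One_nat_def prolong_coeff.simps(2))
  ultimately show ?thesis
    unfolding x by algebra
qed

text \<open>The second prolongation sends the \<nu>-th equation to \<xi> q' y_\<nu> + q \<phi>_\<nu>
  plus the second-order coefficient. On y'' = - q y the terms with y' in that coefficient cancel,
  leaving - (q' f + q f') y_i y_\<nu>, which the first two terms offset.\<close>

lemma C_fun_in_lie_symmetry_algebra:
  assumes "open I" and "smooth_on I q" and sol: "scalar_solution I q f"
  shows "C_fun f i \<in> lie_symmetry_algebra 2 (I \<times> UNIV) (linear_system q)"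
proof -
  have "prolong_apply 2 (C_fun f i) (\<lambda>z. linear_system q z $ \<nu>) z = 0"
    if z: "fst z \<in> I" and sys: "\<And>\<nu>. linear_system q z $ \<nu> = 0" for z \<nu>
  proof -
    let ?F = "\<lambda>z. linear_system q z $ \<nu>"
    have F: "linear_system q z $ \<nu> = snd z 2 $ \<nu> + q (fst z) * snd z 0 $ \<nu>"
      for z :: "'a jet" and \<nu>
      by (simp add: linear_system_def split_beta)
    \<comment> \<open>All components are needed, since the coefficient for \<nu> also contains
      y_i''.\<close>
    have r: "snd z 2 $ \<nu> = - (q (fst z) * snd z 0 $ \<nu>)" for \<nu>
      using sys[of \<nu>] by (simp add: F eq_neg_iff_add_eq_0)
    have "C_k_on (Suc 0) I q"
      using assms(2) by (simp only: smooth_on_def)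
    then have "q differentiable at (fst z)"
      using z by simp
    then obtain q' where q': "(q has_real_derivative q') (at (fst z))"
      by (auto simp: real_differentiable_def)
    have x: "jet_dx ?F z = q' * snd z 0 $ \<nu>"
      unfolding jet_dx_def F by (rule DERIV_imp_deriv) (auto intro!: derivative_eq_intros q')
    have y: "jet_dy 0 l ?F z = axis l 1 $ \<nu> * q (fst z)" for l
      unfolding jet_dy_def F by (rule DERIV_imp_deriv) (auto intro!: derivative_eq_intros)
    have p: "jet_dy 1 l ?F z = 0" for l
      unfolding jet_dy_def F by (rule DERIV_imp_deriv) (auto intro!: derivative_eq_intros)
    have r': "jet_dy 2 l ?F z = axis l 1 $ \<nu>" for l
      unfolding jet_dy_def F by (rule DERIV_imp_deriv) (auto intro!: derivative_eq_intros)
    \<comment> \<open>The prolongation coefficients are plain functions of the index;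
      \<open>vec_lambda\<close> turns them into the vectors expected by
      \<open>sum_mult_axis\<close>.\<close>
    have ax: "(\<Sum>l\<in>UNIV. a l * axis l 1 $ \<nu>) = a \<nu>" for a :: "'a \<Rightarrow> real"
      using sum_mult_axis(1)[of "vec_lambda a"] by simp
    have ax': "(\<Sum>l\<in>UNIV. a l * (axis l 1 $ \<nu> * c)) = a \<nu> * c" for a :: "'a \<Rightarrow> real" and c
      using sum_mult_axis(2)[of "vec_lambda a"] by simp
    have "{..2::nat} = {0, 1, 2}"
      by auto
    then have "prolong_apply 2 (C_fun f i) ?F z = fst (C_fun f i (jet_base z)) * (q' * snd z 0 $ \<nu>)
        + prolong_coeff (C_fun f i) 0 \<nu> z * q (fst z) + prolong_coeff (C_fun f i) 2 \<nu> z"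
      by (simp add: prolong_apply_def x y p[unfolded One_nat_def] r' ax ax' del: prolong_coeff.simps)
    then show ?thesis
      unfolding prolong_coeff_C_fun_2[OF assms(1) sol z q'] r
      by (simp add: C_fun_def jet_base_def algebra_simps)
  qed
  then show ?thesis
    using smooth_on_C_fun[OF assms] by (auto simp: lie_symmetry_algebra_def jet_base_def)
qed

section \<open>Dependence of \<xi> on y, and the theorem\<close>

lemma non_Cartan_C_fun:
  assumes "x \<in> I" and "f x \<noteq> 0"
  shows "non_Cartan (I \<times> UNIV) (C_fun f i)"
proof -
  \<comment> \<open>\<xi> = y_i f is linear in y_i, so its slope along the i-th axis is f x; the
    base point y = 0 is the simplest choice.\<close>
  have "deriv (\<lambda>t. fst (C_fun f i (x, 0 + t *\<^sub>R axis i 1))) 0 = f x"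
    by (rule DERIV_imp_deriv) (auto simp: C_fun_def intro!: derivative_eq_intros)
  then show ?thesis
    unfolding non_Cartan_def using assms by (intro exI[of _ i] bexI[of _ "(x, 0)"]) auto
qed

theorem theorem2:
  fixes I :: "real set" and q u v :: "real \<Rightarrow> real"
    and M :: "(real \<times> (real ^ 'm::finite)) set"
  assumes "open I" and "is_interval I" and "I \<noteq> {}"
    and "smooth_on I q"
    and "scalar_solution I q u" and "scalar_solution I q v"
    and "\<And>a b. (\<forall>x\<in>I. a * u x + b * v x = 0) \<Longrightarrow> a = 0 \<and> b = 0"
    and "\<And>x. x \<in> I \<Longrightarrow> u x * deriv v x - deriv u x * v x = 1"
    and "M = I \<times> UNIV"
  shows "(\<forall>i. \<forall>k\<in>{1,2}. C_field u v i k \<in> lie_symmetry_algebra 2 M (linear_system q)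
                        \<and> non_Cartan M (C_field u v i k))
    \<and> (\<forall>c :: 'm \<Rightarrow> nat \<Rightarrow> real.
         (\<forall>z\<in>M. (\<Sum>i\<in>UNIV. \<Sum>k\<in>{1,2}. c i k *\<^sub>R C_field u v i k z) = 0)
         \<longrightarrow> (\<forall>i. \<forall>k\<in>{1,2}. c i k = 0))
    \<and> (\<forall>i j. \<forall>k\<in>{1,2}. \<forall>l\<in>{1,2}. \<forall>z\<in>M.
         lie_bracket (C_field u v i k) (C_field u v j l) z = 0)"
proof (intro conjI allI ballI impI)
  have M: "M = I \<times> UNIV" by fact
  fix i :: 'm and k :: nat
  assume k: "k \<in> {1, 2}"
  let ?f = "if k = 1 then u else v"
  have sol: "scalar_solution I q ?f"
    using assms(5,6) by simp
  show "C_field u v i k \<in> lie_symmetry_algebra 2 M (linear_system q)"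
    unfolding C_field_eq_C_fun M
    using C_fun_in_lie_symmetry_algebra[OF \<open>open I\<close> \<open>smooth_on I q\<close> sol] .
  \<comment> \<open>Linear independence with coefficients (1, 0) and (0, 1) prevents u and v from
    vanishing identically on \<open>I\<close>.\<close>
  have "\<exists>x\<in>I. ?f x \<noteq> 0"
    using assms(7)[of 1 0] assms(7)[of 0 1] by auto
  then show "non_Cartan M (C_field u v i k)"
    unfolding C_field_eq_C_fun M using non_Cartan_C_fun by metis
next
  fix c :: "'m \<Rightarrow> nat \<Rightarrow> real" and i :: 'm and k :: nat
  assume zero: "\<forall>z\<in>M. (\<Sum>i\<in>UNIV. \<Sum>k\<in>{1,2}. c i k *\<^sub>R C_field u v i k z) = 0"
    and k: "k \<in> {1, 2}"
  \<comment> \<open>Linear independence of the fields makes precise that there are 2m of them. At y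
    = e_i the \<xi>-component of each field with another index vanishes, which leaves a linear
    relation between u and v.\<close>
  have "c i 1 * u x + c i 2 * v x = 0" if "x \<in> I" for x
  proof -
    have "0 = fst (\<Sum>l\<in>UNIV. \<Sum>k\<in>{1,2}. c l k *\<^sub>R C_field u v l k (x, axis i 1))"
      using zero that assms(9) by simp
    also have "\<dots> = (\<Sum>l\<in>UNIV. if l = i then c l 1 * u x + c l 2 * v x else 0)"
      unfolding fst_sum by (rule sum.cong) (auto simp: C_field_eq_C_fun C_fun_def axis_def)
    finally show ?thesis
      by simp
  qed
  then have "c i 1 = 0 \<and> c i 2 = 0"
    using assms(7) by blast
  then show "c i k = 0"
    using k by auto
next
  fix i j :: 'm and k l :: nat and z
  assume "z \<in> M"
  then have "fst z \<in> I"
    using assms(9) by auto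
  then show "lie_bracket (C_field u v i k) (C_field u v j l) z = 0"
    unfolding C_field_eq_C_fun using assms(5,6) by (intro lie_bracket_C_fun) auto
qed

end
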